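(* Let $\mathcal{H}$ be a hypergraph with no isolated vertices. Then each of the following holds: 1. Suppose that every edge in $\mathcal{H}$ has size at most $3$. Then for every $|V(\mathcal{H})| - \left\lceil\frac{\tilde{\gamma}(\mathcal{H})}{2}\right\rceil$ covers of $\mathcal{H}$, there exists a rainbow cover. 2. Suppose that every edge in $\mathcal{H}$ has size at most $2$. Then for every $|V(\mathcal{H})| - \gamma_{si}(\mathcal{H})$ covers of $\mathcal{H}$, there exists a rainbow cover. 3. For every $|V(\mathcal{H})| - \gamma_E(\mathcal{H})$ covers of $\mathcal{H}$, there exists a rainbow cover.
   Context: A hypergraph $\mathcal{H}$ on a finite vertex set $V=V(\mathcal{H})$ is a collection of distinct non-empty subsets of $V$, called edges. A singleton edge $\{v\}$ is called a loop. A vertex is isolated if no edge contains it. A cover of $\mathcal{H}$ is a set of vertices that meets every edge. Rainbow cover: let $l\le m$ be positive integers. Given a family of $m$ covers $X_1,\ldots,X_m$ (not necessarily distinct or disjoint) of $\mathcal{H}$, a rainbow cover of size $l$ is a cover $X=\{x_{i_1},\ldots,x_{i_l}\}$ of $l$ distinct vertices of $\mathcal{H}$ such that $1\le i_1<\cdots<i_l\le m$ and $x_{i_j}\in X_{i_j}$ for each $j\in\{1,\ldots,l\}$. "For every $m$ covers there exists a rainbow cover" means that, with $m$ positive, for any covers $X_1,\dots,X_m$ there is a rainbow cover of some size $l\le m$. Domination: $W\subseteq V$ dominates a vertex $v$ if there is $W'\subseteq W\setminus\{v\}$ with $W'\cup\{v\}\in\mathcal{H}$ (in particular the empty set dominates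 $v$ if $\{v\}$ is a loop). $W$ dominates $A\subseteq V$ if it dominates every vertex of $A$. Let $\gamma(\mathcal{H};A)=\min\{|W| : W\subseteq V,\ W \text{ dominates } A\}$ and $\tilde{\gamma}(\mathcal{H})=\gamma(\mathcal{H};V)$. A set $A\subseteq V$ is strongly independent if it contains no edge of $\mathcal{H}$ and every edge contains at most one vertex of $A$. Let $\gamma_{si}(\mathcal{H})=\max\{\gamma(\mathcal{H};A) : A \text{ strongly independent in } \mathcal{H}\}$. Let $\gamma_E(\mathcal{H})=\min\{|\mathcal{F}| : \mathcal{F}\subseteq\mathcal{H},\ \bigcup_{F\in\mathcal{F}}F \text{ dominates } V\}$. *)

theory Defs
  imports Complex_Main
begin

definition hypergraph :: "'a set \<Rightarrow> 'a set set \<Rightarrow> bool" where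
  "hypergraph V E \<longleftrightarrow> finite V \<and> (\<forall>e\<in>E. e \<noteq> {} \<and> e \<subseteq> V)"

definition isolated :: "'a set set \<Rightarrow> 'a \<Rightarrow> bool" where
  "isolated E v \<longleftrightarrow> (\<forall>e\<in>E. v \<notin> e)"

definition cover :: "'a set \<Rightarrow> 'a set set \<Rightarrow> 'a set \<Rightarrow> bool" where
  "cover V E X \<longleftrightarrow> X \<subseteq> V \<and> (\<forall>e\<in>E. X \<inter> e \<noteq> {})"

text \<open>
  The family of covers is \<open>X 1, \<dots>, X m\<close>. The indices \<open>i\<^sub>1 < \<dots> < i\<^sub>l\<close> are
  given as the \<open>l\<close>-element set \<open>I \<subseteq> {1..m}\<close>, and \<open>x i\<close> is the vertex chosen from \<open>X i\<close>.
\<close>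

definition rainbow_cover ::
    "'a set \<Rightarrow> 'a set set \<Rightarrow> nat \<Rightarrow> (nat \<Rightarrow> 'a set) \<Rightarrow> nat \<Rightarrow> 'a set \<Rightarrow> bool" where
  "rainbow_cover V E m X l Y \<longleftrightarrow>
     0 < l \<and> l \<le> m \<and> cover V E Y \<and>
     (\<exists>I x. I \<subseteq> {1..m} \<and> card I = l \<and> inj_on x I \<and> (\<forall>i\<in>I. x i \<in> X i) \<and> Y = x ` I)"

text \<open>
  Families of covers are indexed by a positive \<open>m\<close>. For the values of \<open>m\<close> used in the theorem,
  \<open>0 < m\<close> fails only for the hypergraph without vertices.
\<close>

definition every_covers_have_rainbow_cover :: "'a set \<Rightarrow> 'a set set \<Rightarrow> nat \<Rightarrow> bool" where
  "every_covers_have_rainbow_cover V E m \<longleftrightarrow>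
     (0 < m \<longrightarrow>
       (\<forall>X. (\<forall>i\<in>{1..m}. cover V E (X i)) \<longrightarrow> (\<exists>l Y. rainbow_cover V E m X l Y)))"

definition dominates_vertex :: "'a set set \<Rightarrow> 'a set \<Rightarrow> 'a \<Rightarrow> bool" where
  "dominates_vertex E W v \<longleftrightarrow> (\<exists>W'. W' \<subseteq> W - {v} \<and> W' \<union> {v} \<in> E)"

definition dominates :: "'a set set \<Rightarrow> 'a set \<Rightarrow> 'a set \<Rightarrow> bool" where
  "dominates E W A \<longleftrightarrow> (\<forall>v\<in>A. dominates_vertex E W v)"

text \<open>
  The minima below are over nonempty sets as soon as there are no isolated vertices
  (\<open>V\<close> and \<open>\<Union>E = V\<close> dominate every vertex), and the maximum is over a nonempty set because
  \<open>{}\<close> is strongly independent.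
\<close>

definition dom_number_on :: "'a set \<Rightarrow> 'a set set \<Rightarrow> 'a set \<Rightarrow> nat" where
  "dom_number_on V E A = Min {card W |W. W \<subseteq> V \<and> dominates E W A}"

definition dom_number :: "'a set \<Rightarrow> 'a set set \<Rightarrow> nat" where
  "dom_number V E = dom_number_on V E V"

definition strongly_independent :: "'a set \<Rightarrow> 'a set set \<Rightarrow> 'a set \<Rightarrow> bool" where
  "strongly_independent V E A \<longleftrightarrow>
     A \<subseteq> V \<and> (\<forall>e\<in>E. \<not> e \<subseteq> A) \<and> (\<forall>e\<in>E. card (e \<inter> A) \<le> 1)"

definition dom_number_si :: "'a set \<Rightarrow> 'a set set \<Rightarrow> nat" where
  "dom_number_si V E = Max {dom_number_on V E A |A. strongly_independent V E A}"

definition dom_number_edges :: "'a set \<Rightarrow> 'a set set \<Rightarrow> nat" where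
  "dom_number_edges V E = Min {card F |F. F \<subseteq> E \<and> dominates E (\<Union>F) V}"

end

theory Submission
  imports Defs
begin

text \<open>
  A rainbow cover is built greedily, one edge at a time. Suppose that an irredundant rainbow set
  \<open>B\<close> covers the edges \<open>D\<close> treated so far but misses the next edge \<open>e\<close>. Then \<open>U = V - B\<close> is a
  maximal independent set of \<open>D\<close> containing \<open>e\<close>. If \<open>U\<close> has more than \<open>card V - m\<close> elements, then
  one of the \<open>m\<close> covers is unused, and one of its vertices in \<open>e\<close> can be added to \<open>B\<close>.
  Being maximal, \<open>U\<close> dominates its complement. Dominating the rest of \<open>U\<close> is cheap, and since the
  vertices of \<open>e\<close> dominate each other, \<open>U\<close> exceeds the respective domination number.
  Edges for which this estimate fails (loops, or the edges that miss an optimal strongly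
  independent set) are treated first, where \<open>U\<close> is large for trivial reasons.
\<close>

section \<open>Irredundant rainbow sets and greedy extension\<close>

text \<open>The \<open>x i\<close> may repeat here. Distinctness is recovered at the end by choosing
  \<open>I\<close> of least size, so it is not carried through the induction.\<close>

definition rainbow_meets :: "nat \<Rightarrow> (nat \<Rightarrow> 'a set) \<Rightarrow> 'a set set \<Rightarrow> bool" where
  "rainbow_meets m X D \<longleftrightarrow>
     (\<exists>I x. I \<subseteq> {1..m} \<and> (\<forall>i\<in>I. x i \<in> X i) \<and> (\<forall>f\<in>D. x ` I \<inter> f \<noteq> {}))"

text \<open>The parameter \<open>D\<close> stands for the edges treated so far, which is why
  domination with respect to the larger set \<open>E\<close> follows from maximality with respect to
  \<open>D\<close>.\<close>

definition maximal_independent :: "'a set \<Rightarrow> 'a set set \<Rightarrow> 'a set \<Rightarrow> bool" where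
  "maximal_independent V D U \<longleftrightarrow>
     U \<subseteq> V \<and> (\<forall>f\<in>D. \<not> f \<subseteq> U) \<and> (\<forall>v\<in>V - U. \<exists>f\<in>D. f \<subseteq> insert v U)"

lemma maximal_independentE:
  assumes "maximal_independent V D U" "v \<in> V" "v \<notin> U"
  obtains f where "f \<in> D" "v \<in> f" "f - {v} \<subseteq> U"
proof -
  have "\<exists>f\<in>D. f \<subseteq> insert v U"
    using assms unfolding maximal_independent_def by simp
  then obtain f where "f \<in> D" "f \<subseteq> insert v U" ..
  moreover from this have "\<not> f \<subseteq> U"
    using assms(1) unfolding maximal_independent_def by simp
  ultimately show thesis
    using that[of f] by auto
qed

text \<open>An index set of least size works. Dropping an index \<open>i\<close> from it uncovers
  some edge, which the image of \<open>I\<close> therefore meets in \<open>x i\<close> only. If two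
  indices carried the same vertex, one of them could be dropped without changing the image.\<close>

lemma rainbow_meets_irredundant:
  assumes "rainbow_meets m X D"
  obtains I x where "I \<subseteq> {1..m}" "\<forall>i\<in>I. x i \<in> X i" "\<forall>f\<in>D. x ` I \<inter> f \<noteq> {}" "inj_on x I"
    "\<forall>i\<in>I. \<exists>f\<in>D. x ` I \<inter> f \<subseteq> {x i}"
proof -
  define P where "P \<equiv> \<lambda>I. \<exists>x. I \<subseteq> {1..m} \<and> (\<forall>i\<in>I. x i \<in> X i) \<and> (\<forall>f\<in>D. x ` I \<inter> f \<noteq> {})"
  obtain I0 where "P I0"
    using assms unfolding rainbow_meets_def P_def by blast
  then obtain I where I: "P I" and min: "\<And>J. P J \<Longrightarrow> card I \<le> card J"
    using ex_has_least_nat[of P I0 card] by blast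
  from I obtain x where x: "I \<subseteq> {1..m}" "\<forall>i\<in>I. x i \<in> X i" "\<forall>f\<in>D. x ` I \<inter> f \<noteq> {}"
    unfolding P_def by blast
  have "finite I"
    using x(1) finite_subset by blast
  have notP: "\<not> P (I - {i})" if "i \<in> I" for i
    using min[of "I - {i}"] card_Diff1_less[OF \<open>finite I\<close> that] by linarith
  have miss: "\<exists>f\<in>D. x ` (I - {i}) \<inter> f = {}" if "i \<in> I" for i
  proof (rule ccontr)
    assume "\<not> ?thesis"
    then have "P (I - {i})"
      unfolding P_def using x by (intro exI[of _ x]) auto
    then show False
      using notP[OF that] by contradiction
  qed
  have "inj_on x I"
  proof (rule inj_onI)
    fix i j assume ij: "i \<in> I" "j \<in> I" "x i = x j"
    show "i = j"
    proof (rule ccontr)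
      assume "i \<noteq> j"
      then have "x ` (I - {i}) = x ` I"
        using ij by (auto simp: image_iff)
      then show False
        using miss[OF ij(1)] x(3) by simp
    qed
  qed
  moreover have "\<forall>i\<in>I. \<exists>f\<in>D. x ` I \<inter> f \<subseteq> {x i}"
  proof
    fix i assume "i \<in> I"
    from miss[OF this] obtain f where "f \<in> D" "x ` (I - {i}) \<inter> f = {}"
      by auto
    then show "\<exists>f\<in>D. x ` I \<inter> f \<subseteq> {x i}"
      by (intro bexI[of _ f]) auto
  qed
  ultimately show thesis
    using that[OF x] by simp
qed

lemma rainbow_meets_insert:
  assumes fin: "finite V" and sub: "\<forall>f\<in>D. f \<subseteq> V" "e \<subseteq> V"
    and X: "\<forall>i\<in>{1..m}. X i \<subseteq> V \<and> X i \<inter> e \<noteq> {}"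
    and big: "\<And>U. maximal_independent V D U \<Longrightarrow> e \<subseteq> U \<Longrightarrow> card V < card U + m"
    and D: "rainbow_meets m X D"
  shows "rainbow_meets m X (insert e D)"
proof -
  obtain I x where I: "I \<subseteq> {1..m}" "\<forall>i\<in>I. x i \<in> X i" "\<forall>f\<in>D. x ` I \<inter> f \<noteq> {}" "inj_on x I"
    and irr: "\<forall>i\<in>I. \<exists>f\<in>D. x ` I \<inter> f \<subseteq> {x i}"
    using rainbow_meets_irredundant[OF D] by metis
  show ?thesis
  proof (cases "x ` I \<inter> e = {}")
    case False
    then show ?thesis
      unfolding rainbow_meets_def
      using I by (intro exI[of _ I] exI[of _ x]) auto
  next
    case True
    define U where "U = V - x ` I"
    have xV: "x ` I \<subseteq> V"
      using I(1,2) X by (meson image_subsetI subsetD)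
    have "maximal_independent V D U"
      unfolding maximal_independent_def
    proof (intro conjI ballI)
      \<comment> \<open>Irredundancy is maximality of the complement: the edge that only
        \<open>v\<close> covers lies in \<open>U\<close> once \<open>v\<close> is added.\<close>
      fix v assume "v \<in> V - U"
      then obtain i where "i \<in> I" "v = x i"
        unfolding U_def by auto
      then obtain f where "f \<in> D" "x ` I \<inter> f \<subseteq> {v}"
        using irr by auto
      then show "\<exists>f\<in>D. f \<subseteq> insert v U"
        using sub(1) unfolding U_def by (intro bexI[of _ f]) auto
    qed (use I(3) U_def in auto)
    then have "card V < card U + m"
      by (rule big) (use True sub(2) U_def in auto)
    moreover have "card U + card I = card V"
      using card_Diff_subset[OF finite_subset[OF xV fin] xV] card_mono[OF fin xV]
        card_image[OF I(4)] unfolding U_def by simp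
    ultimately have "card I < m"
      by simp
    then have "I \<noteq> {1..m}"
      by force
    then obtain j where j: "j \<in> {1..m}" "j \<notin> I"
      using I(1) by blast
    then obtain y where y: "y \<in> X j" "y \<in> e"
      using X by blast
    \<comment> \<open>Since \<open>j\<close> is outside \<open>I\<close>, redefining
      \<open>x\<close> at \<open>j\<close> keeps the old vertices, so the edges of \<open>D\<close>
      remain covered.\<close>
    have "(x(j := y)) ` insert j I = insert y (x ` I)"
      using j(2) by auto
    then show ?thesis
      unfolding rainbow_meets_def
      using I j y by (intro exI[of _ "insert j I"] exI[of _ "x(j := y)"]) auto
  qed
qed

text \<open>The edges of \<open>D1\<close> are added in an unspecified order, so \<open>big\<close>
  has to speak of every intermediate \<open>D\<close> between \<open>D0\<close> and
  \<open>D0 \<union> D1\<close>.\<close>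

lemma rainbow_meets_Un:
  assumes H: "hypergraph V E" and sub: "D0 \<subseteq> E" "D1 \<subseteq> E"
    and X: "\<forall>i\<in>{1..m}. cover V E (X i)"
    and D0: "rainbow_meets m X D0"
    and big: "\<And>D U e. \<lbrakk>D0 \<subseteq> D; D \<subseteq> D0 \<union> D1; e \<in> D1; e \<notin> D; maximal_independent V D U; e \<subseteq> U\<rbrakk>
      \<Longrightarrow> card V < card U + m"
  shows "rainbow_meets m X (D0 \<union> D1)"
proof -
  have fin: "finite V" and EV: "\<forall>f\<in>E. f \<subseteq> V"
    using H unfolding hypergraph_def by auto
  have "finite D1"
    using sub(2) EV fin by (meson PowI finite_Pow_iff finite_subset subsetI subset_eq)
  moreover have "rainbow_meets m X (D0 \<union> F)" if "finite F" "F \<subseteq> D1" for F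
    using that
  proof (induction F rule: finite_induct)
    case empty
    then show ?case using D0 by simp
  next
    case (insert e F)
    show ?case
    proof (cases "e \<in> D0")
      case True
      then show ?thesis
        using insert by (simp add: insert_absorb)
    next
      case False
      have "rainbow_meets m X (insert e (D0 \<union> F))"
      proof (rule rainbow_meets_insert[OF fin])
        show "\<forall>f\<in>D0 \<union> F. f \<subseteq> V" "e \<subseteq> V"
          using insert.prems sub EV by auto
        show "\<forall>i\<in>{1..m}. X i \<subseteq> V \<and> X i \<inter> e \<noteq> {}"
          using X insert.prems sub unfolding cover_def by auto
        show "card V < card U + m" if "maximal_independent V (D0 \<union> F) U" "e \<subseteq> U" for U
          using big[OF _ _ _ _ that] insert False by blast
      qed (use insert in simp)
      then show ?thesis by simp
    qed
  qed
  ultimately show ?thesis by blast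
qed

lemma rainbow_meets_empty [simp]: "rainbow_meets m X {}"
  unfolding rainbow_meets_def by blast

text \<open>Two greedy stages. While \<open>D0\<close> is treated, only edges of \<open>D0\<close>
  are present, which \<open>big0\<close> may exploit; in the second stage \<open>D\<close> can be
  any set of edges.\<close>

lemma every_covers_have_rainbow_coverI:
  assumes H: "hypergraph V E" and iso: "\<forall>v\<in>V. \<not> isolated E v"
    and E: "D0 \<union> D1 = E"
    and big0: "\<And>D U e. \<lbrakk>D \<subseteq> D0; e \<in> D0; e \<notin> D; maximal_independent V D U; e \<subseteq> U\<rbrakk>
      \<Longrightarrow> k < card U"
    and big1: "\<And>D U e. \<lbrakk>D \<subseteq> E; e \<in> D1; e \<notin> D; maximal_independent V D U; e \<subseteq> U\<rbrakk>
      \<Longrightarrow> k < card U"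
  shows "every_covers_have_rainbow_cover V E (card V - k)"
  unfolding every_covers_have_rainbow_cover_def
proof (intro impI allI)
  fix X assume pos: "0 < card V - k" and X: "\<forall>i\<in>{1..card V - k}. cover V E (X i)"
  define m where "m = card V - k"
  have X: "\<forall>i\<in>{1..m}. cover V E (X i)"
    using X unfolding m_def .
  \<comment> \<open>As \<open>m\<close> is positive, the truncated subtraction is exact:
    \<open>card V = k + m\<close>.\<close>
  have bigm: "card V < card U + m" if "k < card U" for U :: "'a set"
    using that pos unfolding m_def by linarith
  have "rainbow_meets m X ({} \<union> D0)"
    by (rule rainbow_meets_Un[OF H _ _ X]) (use E big0 bigm in auto)
  then have "rainbow_meets m X (D0 \<union> D1)"
    by (intro rainbow_meets_Un[OF H _ _ X]) (use E big1 bigm in auto)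
  then obtain I x where I: "I \<subseteq> {1..m}" "\<forall>i\<in>I. x i \<in> X i" "\<forall>f\<in>E. x ` I \<inter> f \<noteq> {}" "inj_on x I"
    using rainbow_meets_irredundant E by metis
  \<comment> \<open>There is a vertex, hence an edge, and covering it takes at least one index; this
    gives the positive size of the rainbow cover.\<close>
  have "V \<noteq> {}"
    using pos by auto
  then obtain e where "e \<in> E"
    using iso unfolding isolated_def by blast
  then have "I \<noteq> {}"
    using I(3) by blast
  then have "0 < card I" "card I \<le> m"
    using I(1) card_mono[OF _ I(1)] finite_subset[OF I(1)] by (auto simp: card_gt_0_iff)
  moreover have "x ` I \<subseteq> V"
    using I(1,2) X unfolding cover_def by (meson image_subsetI subsetD)
  then have "cover V E (x ` I)"
    using I(3) unfolding cover_def by simp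
  ultimately have "rainbow_cover V E m X (card I) (x ` I)"
    unfolding rainbow_cover_def using I by (intro conjI exI[of _ I] exI[of _ x]) auto
  then show "\<exists>l Y. rainbow_cover V E (card V - k) X l Y"
    unfolding m_def by blast
qed

section \<open>Bounds on domination numbers and the case of loops\<close>

lemma dominates_vertexI:
  "f \<in> E \<Longrightarrow> v \<in> f \<Longrightarrow> f - {v} \<subseteq> W \<Longrightarrow> dominates_vertex E W v"
  unfolding dominates_vertex_def by (intro exI[of _ "f - {v}"]) (auto simp: insert_absorb)

lemma dom_number_on_le:
  assumes "finite V" "W \<subseteq> V" "dominates E W A"
  shows "dom_number_on V E A \<le> card W"
proof -
  have "finite {card W |W. W \<subseteq> V \<and> dominates E W A}"
    by (rule finite_subset[of _ "card ` Pow V"]) (use assms(1) in auto)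
  then show ?thesis
    unfolding dom_number_on_def using assms by (intro Min_le) auto
qed

lemma dom_number_edges_le:
  assumes "finite E" "F \<subseteq> E" "dominates E (\<Union>F) V"
  shows "dom_number_edges V E \<le> card F"
proof -
  have "finite {card F |F. F \<subseteq> E \<and> dominates E (\<Union>F) V}"
    by (rule finite_subset[of _ "card ` Pow E"]) (use assms(1) in auto)
  then show ?thesis
    unfolding dom_number_edges_def using assms by (intro Min_le) auto
qed

lemma dom_number_si_attained:
  assumes "hypergraph V E"
  obtains A where "strongly_independent V E A" "dom_number_si V E = dom_number_on V E A"
proof -
  let ?S = "{dom_number_on V E A |A. strongly_independent V E A}"
  have "strongly_independent V E {}"
    using assms unfolding strongly_independent_def hypergraph_def by auto
  then have "?S \<noteq> {}"
    by blast
  moreover have "finite ?S"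
    by (rule finite_subset[of _ "dom_number_on V E ` Pow V"])
      (use assms in \<open>auto simp: hypergraph_def strongly_independent_def\<close>)
  ultimately have "dom_number_si V E \<in> ?S"
    unfolding dom_number_si_def using Max_in by blast
  then show thesis
    using that by blast
qed

lemma card_UN_le_mult:
  assumes "finite I" "\<And>i. i \<in> I \<Longrightarrow> card (A i) \<le> k"
  shows "card (\<Union>i\<in>I. A i) \<le> k * card I"
  using card_UN_le[OF assms(1), of A] sum_bounded_above[of I "\<lambda>i. card (A i)" k] assms(2)
  by (fastforce simp: mult.commute)

text \<open>A vertex outside \<open>U\<close> is blocked by an edge of \<open>D\<close>, which must
  be its own loop. So \<open>U\<close> contains every vertex without a loop, and also the vertex of
  \<open>e\<close>, which has one.\<close>

lemma maximal_independent_of_loops: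
  assumes fin: "finite V" and D: "D \<subseteq> {f \<in> E. card f = 1}"
    and e: "e \<in> E" "card e = 1" "e \<notin> D" "e \<subseteq> U"
    and U: "maximal_independent V D U"
  shows "card {v \<in> V. {v} \<notin> E} < card U"
proof -
  obtain u where u: "e = {u}"
    using e(2) card_1_singletonE by blast
  have "v \<in> U" if "v \<in> V" "{v} \<notin> D" for v
  proof (rule ccontr)
    assume "v \<notin> U"
    with U that(1) obtain f where f: "f \<in> D" "v \<in> f"
      by (rule maximal_independentE)
    then have "f = {v}"
      using D card_1_singletonE by force
    then show False
      using f that by simp
  qed
  then have "{v \<in> V. {v} \<notin> E} \<subset> U"
    using D u e by blast
  moreover have "U \<subseteq> V"
    using U unfolding maximal_independent_def by simp
  then have "finite U"
    using fin by (rule finite_subset)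
  ultimately show ?thesis
    by (intro psubset_card_mono)
qed

lemma edge_choice:
  assumes "\<forall>v\<in>V. \<not> isolated E v"
  obtains f where "\<And>v. v \<in> V \<Longrightarrow> f v \<in> E" "\<And>v. v \<in> V \<Longrightarrow> v \<in> f v"
  using assms bchoice[of V "\<lambda>v f. f \<in> E \<and> v \<in> f"] unfolding isolated_def by blast

section \<open>Edges of size at most three\<close>

text \<open>Loops go first. For an edge \<open>e\<close> of size 2 or 3, a dominating set with at
  most \<open>2 * card U - card e\<close> vertices is built from \<open>U\<close>, and
  \<open>card e\<close> is at least 2.\<close>

lemma rainbow_cover_edges_le_3:
  assumes H: "hypergraph V E" and iso: "\<forall>v\<in>V. \<not> isolated E v"
    and card3: "\<forall>e\<in>E. card e \<le> 3"
  shows "every_covers_have_rainbow_cover V E (card V - nat \<lceil>real (dom_number V E) / 2\<rceil>)"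
proof (rule every_covers_have_rainbow_coverI[OF H iso])
  let ?L = "{f \<in> E. card f = 1}" and ?M = "{f \<in> E. card f \<noteq> 1}"
  have fin: "finite V" and EV: "\<And>f. f \<in> E \<Longrightarrow> f \<subseteq> V" and E0: "\<And>f. f \<in> E \<Longrightarrow> f \<noteq> {}"
    using H unfolding hypergraph_def by auto
  have finE: "finite f" if "f \<in> E" for f
    by (rule finite_subset[OF EV[OF that] fin])
  obtain h where h: "\<And>v. v \<in> V \<Longrightarrow> h v \<in> E" "\<And>v. v \<in> V \<Longrightarrow> v \<in> h v"
    using edge_choice[OF iso] by blast
  have half: "nat \<lceil>real (dom_number V E) / 2\<rceil> < k" if "dom_number V E + 2 \<le> 2 * k" for k
    using that by linarith
  have two: "card (f - {v}) \<le> 2" if "f \<in> E" "v \<in> f" for f v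
    using card3[rule_format, OF that(1)] that(2) by (simp add: card_Diff_singleton)
  show "?L \<union> ?M = E"
    by blast
  show "nat \<lceil>real (dom_number V E) / 2\<rceil> < card U"
    if D: "D \<subseteq> ?L" and e: "e \<in> ?L" "e \<notin> D" "e \<subseteq> U" and U: "maximal_independent V D U" for D U e
  proof -
    let ?N = "{v \<in> V. {v} \<notin> E}"
    \<comment> \<open>Vertices with a loop are dominated by the empty set; each other vertex costs
      at most two.\<close>
    define W where "W = (\<Union>v\<in>?N. h v - {v})"
    have "dominates_vertex E W v" if "v \<in> V" for v
    proof (cases "v \<in> ?N")
      case True
      then show ?thesis
        by (intro dominates_vertexI[of "h v"]) (use h that W_def in auto)
    next
      case False
      then show ?thesis
        by (intro dominates_vertexI[of "{v}"]) (use that in auto)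
    qed
    then have "dominates E W V"
      unfolding dominates_def by simp
    moreover have "W \<subseteq> V"
      unfolding W_def using EV[OF h(1)] by blast
    ultimately have "dom_number V E \<le> card W"
      unfolding dom_number_def by (intro dom_number_on_le[OF fin])
    also have "card W \<le> 2 * card ?N"
      unfolding W_def by (rule card_UN_le_mult) (use fin two[OF h] in auto)
    finally show ?thesis
      using maximal_independent_of_loops[OF fin D _ _ _ e(3) U] e by (intro half) auto
  qed
  show "nat \<lceil>real (dom_number V E) / 2\<rceil> < card U"
    if D: "D \<subseteq> E" and e: "e \<in> ?M" "e \<notin> D" "e \<subseteq> U" and U: "maximal_independent V D U" for D U e
  proof -
    have UV: "U \<subseteq> V"
      using U unfolding maximal_independent_def by simp
    then have finU: "finite U"
      using fin by (rule finite_subset)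
    \<comment> \<open>Vertices of \<open>U\<close> outside \<open>G\<close> help to dominate neither \<open>V - U\<close> nor \<open>G\<close>, so they can be left
      out of the dominating set; this pays for the two vertices needed to dominate each of them.\<close>
    define G where "G = {u \<in> U. \<exists>g\<in>E. u \<in> g \<and> card (g - U) \<le> 1}"
    have GU: "G \<subseteq> U" and finG: "finite G"
      using finU unfolding G_def by auto
    have G: "g \<inter> U \<subseteq> G" if "g \<in> E" "card (g - U) \<le> 1" for g
      using that unfolding G_def by blast
    have eG: "e \<subseteq> G"
    proof -
      have "card (e - U) = 0" "e \<inter> U = e"
        using e(3) by (simp_all add: Diff_eq_empty_iff[THEN iffD2] Int_absorb2)
      then show ?thesis
        using G[of e] e(1) by simp
    qed
    \<comment> \<open>For \<open>u\<close> in \<open>G\<close> the edge is the witness from the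
      definition of \<open>G\<close>; for other \<open>u\<close> any edge through \<open>u\<close>
      will do.\<close>
    have "\<forall>u\<in>U. \<exists>g. g \<in> E \<and> u \<in> g \<and> (u \<in> G \<longrightarrow> card (g - U) \<le> 1)"
    proof
      fix u assume "u \<in> U"
      then show "\<exists>g. g \<in> E \<and> u \<in> g \<and> (u \<in> G \<longrightarrow> card (g - U) \<le> 1)"
        using h[OF subsetD[OF UV]] unfolding G_def by (cases "u \<in> G") (auto simp: G_def)
    qed
    from bchoice[OF this] obtain f where
      f': "\<forall>u\<in>U. f u \<in> E \<and> u \<in> f u \<and> (u \<in> G \<longrightarrow> card (f u - U) \<le> 1)" ..
    then have f: "\<And>u. u \<in> U \<Longrightarrow> f u \<in> E" "\<And>u. u \<in> U \<Longrightarrow> u \<in> f u"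
      "\<And>u. u \<in> G \<Longrightarrow> card (f u - U) \<le> 1"
      using subsetD[OF GU] by simp_all
    \<comment> \<open>Besides \<open>G\<close> itself, this costs nothing for \<open>e\<close>, at
      most one vertex for each element of \<open>G - e\<close> and at most two for each element of
      \<open>U - G\<close>.\<close>
    define W where "W = G \<union> (\<Union>u\<in>G - e. f u - U) \<union> (\<Union>u\<in>U - G. f u - U)"
    have "dominates_vertex E W v" if v: "v \<in> V" for v
    proof -
      consider "v \<in> e" | "v \<in> G - e" | "v \<in> U - G" | "v \<notin> U"
        by blast
      then show ?thesis
      proof cases
        case 1
        then show ?thesis
          using e(1) eG by (intro dominates_vertexI[of e]) (auto simp: W_def)
      next
        case 2
        then have v: "v \<in> G" "v \<in> U"
          using GU by auto
        have "f v - U \<subseteq> W"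
          using 2 unfolding W_def by blast
        moreover have "f v \<inter> U \<subseteq> W"
          using G[OF f(1)[OF v(2)] f(3)[OF v(1)]] unfolding W_def by blast
        ultimately have "f v - {v} \<subseteq> W"
          by blast
        then show ?thesis
          by (rule dominates_vertexI[OF f(1,2)[OF v(2)]])
      next
        case 3
        then have v: "v \<in> U" ..
        \<comment> \<open>Since \<open>v\<close> is not in \<open>G\<close>, the edge has at least
          two vertices outside \<open>U\<close>. Its size is at most 3, so these are all its
          vertices but \<open>v\<close>.\<close>
        have "\<not> card (f v - U) \<le> 1"
          using 3 f(1,2)[OF v] unfolding G_def by simp
        moreover have "card (f v - {v}) \<le> 2" "finite (f v - {v})"
          using two f(1,2)[OF v] finE by simp_all
        moreover have "f v - U \<subseteq> f v - {v}"
          using 3 by blast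
        ultimately have "f v - U = f v - {v}"
          by (intro card_seteq) auto
        moreover have "f v - U \<subseteq> W"
          using 3 unfolding W_def by blast
        ultimately show ?thesis
          using dominates_vertexI[OF f(1,2)[OF v]] by simp
      next
        case 4
        then obtain g where g: "g \<in> D" "v \<in> g" "g - {v} \<subseteq> U"
          by (rule maximal_independentE[OF U v])
        have "g \<in> E"
          using D g(1) by (rule subsetD)
        \<comment> \<open>Only \<open>v\<close> lies outside \<open>U\<close>, so \<open>g\<close>
          itself witnesses that its other vertices belong to \<open>G\<close>.\<close>
        have "card (g - U) \<le> card {v}"
          using g(3) by (intro card_mono) auto
        then have "g \<inter> U \<subseteq> W"
          using G[OF \<open>g \<in> E\<close>] unfolding W_def by auto
        then show ?thesis
          using g(3) by (intro dominates_vertexI[OF \<open>g \<in> E\<close> g(2)]) auto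
      qed
    qed
    then have "dominates E W V"
      unfolding dominates_def by simp
    moreover have "W \<subseteq> V"
      unfolding W_def using EV[OF f(1)] GU UV by blast
    ultimately have "dom_number V E \<le> card W"
      unfolding dom_number_def by (intro dom_number_on_le[OF fin])
    also have "\<dots> \<le> card G + card (\<Union>u\<in>G - e. f u - U) + card (\<Union>u\<in>U - G. f u - U)"
      unfolding W_def by (meson add_mono card_Un_le le_refl le_trans)
    also have "card (\<Union>u\<in>G - e. f u - U) \<le> 1 * card (G - e)"
      by (rule card_UN_le_mult) (use f(3) finG in auto)
    also have "card (\<Union>u\<in>U - G. f u - U) \<le> 2 * card (U - G)"
    proof (rule card_UN_le_mult)
      fix u assume u: "u \<in> U - G"
      then have "card (f u - U) \<le> card (f u - {u})"
        using finE[OF f(1)] by (intro card_mono) auto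
      also have "\<dots> \<le> 2"
        using u two[OF f(1,2)] by simp
      finally show "card (f u - U) \<le> 2" .
    qed (use finU in simp)
    \<comment> \<open>The right-hand side equals \<open>2 * card U - card e\<close>. As
      \<open>e\<close> is neither empty nor a loop, this is at most
      \<open>2 * card U - 2\<close>.\<close>
    finally have "dom_number V E \<le> card G + card (G - e) + 2 * card (U - G)"
      by simp
    moreover have "card (G - e) + card e = card G" "card (U - G) + card G = card U"
      using card_Diff_subset[OF finite_subset[OF eG finG] eG] card_mono[OF finG eG]
        card_Diff_subset[OF finG GU] card_mono[OF finU GU] by simp_all
    moreover have "card e \<noteq> 0" "card e \<noteq> 1"
      using e E0 finE by auto
    ultimately show ?thesis
      by (intro half) linarith
  qed
qed

section \<open>Edges of size at most two and strongly independent sets\<close>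

text \<open>Edges missing an optimal \<open>A\<close> go first: while only they are present,
  \<open>A\<close> stays inside \<open>U\<close>. An edge \<open>e\<close> that meets
  \<open>A\<close> does so in a single vertex \<open>u\<close>, which the rest of \<open>e\<close>
  dominates from within \<open>U - A\<close>, so one vertex is saved.\<close>

lemma rainbow_cover_edges_le_2:
  assumes H: "hypergraph V E" and iso: "\<forall>v\<in>V. \<not> isolated E v"
    and card2: "\<forall>e\<in>E. card e \<le> 2"
  shows "every_covers_have_rainbow_cover V E (card V - dom_number_si V E)"
proof -
  obtain A where A: "strongly_independent V E A" and si: "dom_number_si V E = dom_number_on V E A"
    using dom_number_si_attained[OF H] by blast
  let ?L = "{f \<in> E. f \<inter> A = {}}" and ?M = "{f \<in> E. f \<inter> A \<noteq> {}}"
  have fin: "finite V" and EV: "\<And>f. f \<in> E \<Longrightarrow> f \<subseteq> V" and E0: "\<And>f. f \<in> E \<Longrightarrow> f \<noteq> {}"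
    using H unfolding hypergraph_def by auto
  have AV: "A \<subseteq> V" and finA: "finite A"
    using A finite_subset[OF _ fin] unfolding strongly_independent_def by auto
  have meet: "f \<inter> A = {a}" if "f \<in> E" "a \<in> f" "a \<in> A" for f a
  proof -
    have "card (f \<inter> A) \<le> card {a}"
      using A that unfolding strongly_independent_def by simp
    then show ?thesis
      using card_seteq[of "f \<inter> A" "{a}"] finA that by auto
  qed
  obtain h where h: "\<And>v. v \<in> V \<Longrightarrow> h v \<in> E" "\<And>v. v \<in> V \<Longrightarrow> v \<in> h v"
    using edge_choice[OF iso] by blast
  have one: "card (h v - {v}) \<le> 1" if "v \<in> V" for v
  proof -
    have "finite (h v)"
      by (rule finite_subset[OF EV[OF h(1)[OF that]] fin])
    then show ?thesis
      using card2[rule_format, OF h(1)[OF that]] h(2)[OF that] by (simp add: card_Diff_singleton)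
  qed
  show ?thesis
    unfolding si
  proof (rule every_covers_have_rainbow_coverI[OF H iso])
    show "?L \<union> ?M = E"
      by blast
    show "dom_number_on V E A < card U"
      if D: "D \<subseteq> ?L" and e: "e \<in> ?L" "e \<notin> D" "e \<subseteq> U" and U: "maximal_independent V D U" for D U e
    proof -
      define W where "W = (\<Union>a\<in>A. h a - {a})"
      have "dominates E W A"
        unfolding dominates_def
      proof
        fix a assume a: "a \<in> A"
        show "dominates_vertex E W a"
          using h[OF subsetD[OF AV a]]
          by (rule dominates_vertexI) (use a in \<open>auto simp: W_def\<close>)
      qed
      moreover have "W \<subseteq> V"
        unfolding W_def using EV[OF h(1)] AV by blast
      ultimately have "dom_number_on V E A \<le> card W"
        by (intro dom_number_on_le[OF fin])
      also have "\<dots> \<le> 1 * card A"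
        unfolding W_def by (rule card_UN_le_mult) (use finA one AV in auto)
      also have "\<dots> < card U"
      proof -
        \<comment> \<open>No edge of \<open>D\<close> meets \<open>A\<close>, so none can block a
          vertex of \<open>A\<close>. The inclusion is strict because \<open>U\<close> also contains
          the nonempty \<open>e\<close>, which misses \<open>A\<close>.\<close>
        have "A \<subseteq> U"
        proof
          fix a assume a: "a \<in> A"
          show "a \<in> U"
          proof (rule ccontr)
            have "a \<in> V"
              using AV a by blast
            moreover assume "a \<notin> U"
            ultimately obtain g where "g \<in> D" "a \<in> g"
              using U by (metis maximal_independentE)
            then show False
              using D a by blast
          qed
        qed
        then have "A \<subset> U"
          using e E0 by blast
        moreover have "U \<subseteq> V"
          using U unfolding maximal_independent_def by simp
        then have "finite U"
          using fin by (rule finite_subset)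
        ultimately show ?thesis
          using psubset_card_mono by simp
      qed
      finally show ?thesis .
    qed
    show "dom_number_on V E A < card U"
      if D: "D \<subseteq> E" and e: "e \<in> ?M" "e \<notin> D" "e \<subseteq> U" and U: "maximal_independent V D U" for D U e
    proof -
      have UV: "U \<subseteq> V"
        using U unfolding maximal_independent_def by simp
      then have finU: "finite U"
        using fin by (rule finite_subset)
      obtain u where u: "u \<in> e" "u \<in> A"
        using e by blast
      \<comment> \<open>The part \<open>U - A\<close> dominates \<open>u\<close> through
        \<open>e\<close>, and the vertices of \<open>A\<close> outside \<open>U\<close> by
        maximality, since an edge meets \<open>A\<close> only once. Every remaining vertex of
        \<open>A\<close> costs at most one.\<close>
      define W where "W = (U - A) \<union> (\<Union>a\<in>A \<inter> U - {u}. h a - {a})"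
      have "dominates_vertex E W a" if a: "a \<in> A" for a
      proof -
        consider "a = u" | "a \<in> U - {u}" | "a \<notin> U"
          by blast
        then show ?thesis
        proof cases
          case 1
          then show ?thesis
            using u e meet[of e u] by (intro dominates_vertexI[of e]) (auto simp: W_def)
        next
          case 2
          then show ?thesis
            using a h[OF subsetD[OF AV a]]
            by (intro dominates_vertexI[of "h a"]) (auto simp: W_def)
        next
          case 3
          have "a \<in> V"
            using AV a by blast
          then obtain g where g: "g \<in> D" "a \<in> g" "g - {a} \<subseteq> U"
            using 3 by (rule maximal_independentE[OF U])
          then show ?thesis
            using a meet[OF subsetD[OF D g(1)] g(2) a]
            by (intro dominates_vertexI[OF subsetD[OF D g(1)] g(2)]) (auto simp: W_def)
        qed
      qed
      then have "dominates E W A"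
        unfolding dominates_def by simp
      moreover have "W \<subseteq> V"
        unfolding W_def using EV[OF h(1)] AV UV by blast
      ultimately have "dom_number_on V E A \<le> card W"
        by (intro dom_number_on_le[OF fin])
      also have "\<dots> \<le> card (U - A) + card (\<Union>a\<in>A \<inter> U - {u}. h a - {a})"
        unfolding W_def by (rule card_Un_le)
      also have "card (\<Union>a\<in>A \<inter> U - {u}. h a - {a}) \<le> 1 * card (A \<inter> U - {u})"
        by (rule card_UN_le_mult) (use finA one AV in auto)
      also have "card (U - A) + 1 * card (A \<inter> U - {u}) < card U"
      proof -
        have "card (A \<inter> U - {u}) < card (A \<inter> U)"
          using u e finA by (intro card_Diff1_less) auto
        moreover have "card (U - A) + card (A \<inter> U) = card U"
          using card_Diff_subset_Int[of U A] card_mono[of U "U \<inter> A"] finU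
          by (simp add: Int_commute)
        ultimately show ?thesis by simp
      qed
      finally show ?thesis by simp
    qed
  qed
qed

section \<open>Domination by unions of edges\<close>

text \<open>Loops go first. For a larger \<open>e\<close>, the single edge \<open>e\<close> serves
  all of its at least two vertices, and one edge for each vertex of \<open>U - e\<close> completes a
  dominating family with fewer than \<open>card U\<close> members.\<close>

lemma rainbow_cover_edge_domination:
  assumes H: "hypergraph V E" and iso: "\<forall>v\<in>V. \<not> isolated E v"
  shows "every_covers_have_rainbow_cover V E (card V - dom_number_edges V E)"
proof (rule every_covers_have_rainbow_coverI[OF H iso])
  let ?L = "{f \<in> E. card f = 1}" and ?M = "{f \<in> E. card f \<noteq> 1}"
  have fin: "finite V" and EV: "\<And>f. f \<in> E \<Longrightarrow> f \<subseteq> V" and E0: "\<And>f. f \<in> E \<Longrightarrow> f \<noteq> {}"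
    using H unfolding hypergraph_def by auto
  have finE: "finite E"
    by (rule finite_subset[of _ "Pow V"]) (use fin EV in auto)
  obtain h where h: "\<And>v. v \<in> V \<Longrightarrow> h v \<in> E" "\<And>v. v \<in> V \<Longrightarrow> v \<in> h v"
    using edge_choice[OF iso] by blast
  show "?L \<union> ?M = E"
    by blast
  show "dom_number_edges V E < card U"
    if D: "D \<subseteq> ?L" and e: "e \<in> ?L" "e \<notin> D" "e \<subseteq> U" and U: "maximal_independent V D U" for D U e
  proof -
    let ?N = "{v \<in> V. {v} \<notin> E}"
    have "dominates_vertex E (\<Union>(h ` ?N)) v" if "v \<in> V" for v
    proof (cases "v \<in> ?N")
      case True
      then show ?thesis
        by (intro dominates_vertexI[of "h v"]) (use h that in auto)
    next
      case False
      then show ?thesis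
        by (intro dominates_vertexI[of "{v}"]) (use that in auto)
    qed
    then have "dom_number_edges V E \<le> card (h ` ?N)"
      by (intro dom_number_edges_le[OF finE]) (use h(1) in \<open>auto simp: dominates_def\<close>)
    also have "\<dots> \<le> card ?N"
      using fin by (intro card_image_le) auto
    also have "\<dots> < card U"
      using maximal_independent_of_loops[OF fin D _ _ _ e(3) U] e by auto
    finally show ?thesis .
  qed
  show "dom_number_edges V E < card U"
    if D: "D \<subseteq> E" and e: "e \<in> ?M" "e \<notin> D" "e \<subseteq> U" and U: "maximal_independent V D U" for D U e
  proof -
    have UV: "U \<subseteq> V"
      using U unfolding maximal_independent_def by simp
    then have finU: "finite U"
      using fin by (rule finite_subset)
    \<comment> \<open>The union of \<open>F\<close> contains \<open>U\<close>, which dominates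
      \<open>V - U\<close>; a vertex of \<open>U\<close> is dominated through the edge of
      \<open>F\<close> chosen for it.\<close>
    define F where "F = insert e (h ` (U - e))"
    have UF: "u \<in> \<Union>F" if "u \<in> U" for u
    proof (cases "u \<in> e")
      case True
      then show ?thesis
        unfolding F_def by simp
    next
      case False
      then have "h u \<in> F"
        unfolding F_def using that by simp
      then show ?thesis
        using h(2)[OF subsetD[OF UV that]] by (rule UnionI)
    qed
    have "dominates_vertex E (\<Union>F) v" if v: "v \<in> V" for v
    proof -
      consider "v \<in> e" | "v \<in> U - e" | "v \<notin> U"
        by blast
      then show ?thesis
      proof cases
        case 1
        then show ?thesis
          using e(1) by (intro dominates_vertexI[of e]) (auto simp: F_def)
      next
        case 2
        then show ?thesis
          using h[OF v] by (intro dominates_vertexI[of "h v"]) (auto simp: F_def)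
      next
        case 3
        then obtain g where g: "g \<in> D" "v \<in> g" "g - {v} \<subseteq> U"
          by (rule maximal_independentE[OF U v])
        show ?thesis
          using subsetD[OF D g(1)] g(2) by (rule dominates_vertexI) (use UF g(3) in blast)
      qed
    qed
    then have "dominates E (\<Union>F) V"
      unfolding dominates_def by simp
    moreover have "F \<subseteq> E"
      unfolding F_def using e(1) h(1)[OF subsetD[OF UV]] by auto
    ultimately have "dom_number_edges V E \<le> card F"
      by (intro dom_number_edges_le[OF finE])
    also have "\<dots> \<le> Suc (card (h ` (U - e)))"
      unfolding F_def by (rule card_insert_le_m1) auto
    also have "\<dots> \<le> Suc (card (U - e))"
      using finU by (simp add: card_image_le)
    also have "\<dots> < card U"
    proof -
      have "finite e"
        by (rule finite_subset[OF e(3) finU])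
      then have "card (U - e) + card e = card U"
        using e(3) card_mono[OF finU e(3)] by (simp add: card_Diff_subset)
      moreover have "card e \<noteq> 0" "card e \<noteq> 1"
        using e E0 \<open>finite e\<close> by auto
      ultimately show ?thesis by linarith
    qed
    finally show ?thesis .
  qed
qed

theorem corollary5p4:
  fixes V :: "'a set" and E :: "'a set set"
  assumes "hypergraph V E"
    and "\<forall>v\<in>V. \<not> isolated E v"
  shows "((\<forall>e\<in>E. card e \<le> 3) \<longrightarrow>
            every_covers_have_rainbow_cover V E
              (card V - nat \<lceil>real (dom_number V E) / 2\<rceil>)) \<and>
         ((\<forall>e\<in>E. card e \<le> 2) \<longrightarrow>
            every_covers_have_rainbow_cover V E (card V - dom_number_si V E)) \<and>
         every_covers_have_rainbow_cover V E (card V - dom_number_edges V E)"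
  using rainbow_cover_edges_le_3[OF assms] rainbow_cover_edges_le_2[OF assms]
    rainbow_cover_edge_domination[OF assms] by blast

end
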